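(* Let $n \geq 1$ and let $G$ be the sibling tree $ST_n$. Then the domination number of $G$ is $$\gamma(G) = \begin{cases} \frac{1}{7}(2^{n+2}+3) & \text{if } n\equiv 0 \pmod 3,\\ \frac{1}{7}(2^{n+2}-1) & \text{if } n\equiv 1 \pmod 3,\\ \frac{2}{7}(2^{n+1}-1) & \text{if } n\equiv 2 \pmod 3.\end{cases}$$
   Context: The sibling tree $ST_n$ has vertex set $\{1,2,\dots,2^{n+1}-1\}$; its edges are the edges of the complete binary tree of height $n$ in which vertex $x$ has children $2x$ and $2x+1$ (root $1$ at level $0$; vertex $v$ is at level $i$ iff $2^i\le v\le 2^{i+1}-1$), together with the sibling edges $\{2x,2x+1\}$ for every $x$ with $1\le x\le 2^n-1$. A set $S\subseteq V(G)$ is dominating if every vertex of $V(G)\setminus S$ is adjacent to some vertex of $S$; $\gamma(G)$ is the minimum cardinality of a dominating set. *)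

theory Defs
  imports Complex_Main
begin

text \<open>A finite simple graph is given by its vertex set and its edge set, the latter a set of
  two-element vertex sets.\<close>

definition adjacent :: "'a set set \<Rightarrow> 'a \<Rightarrow> 'a \<Rightarrow> bool" where
  "adjacent E u v \<longleftrightarrow> {u, v} \<in> E"

definition dominating :: "'a set \<Rightarrow> 'a set set \<Rightarrow> 'a set \<Rightarrow> bool" where
  "dominating V E S \<longleftrightarrow> S \<subseteq> V \<and> (\<forall>v \<in> V - S. \<exists>s \<in> S. adjacent E v s)"

definition domination_number :: "'a set \<Rightarrow> 'a set set \<Rightarrow> nat" where
  "domination_number V E = Min (card ` {S. dominating V E S})"

definition ST_verts :: "nat \<Rightarrow> nat set" where
  "ST_verts n = {1..2 ^ (n + 1) - 1}"

text \<open>The vertices that have children are exactly \<open>1, \<dots>, 2 ^ n - 1\<close>.\<close>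

definition binary_tree_edges :: "nat \<Rightarrow> nat set set" where
  "binary_tree_edges n =
     {{x, 2 * x} | x. x \<in> {1..2 ^ n - 1}} \<union> {{x, 2 * x + 1} | x. x \<in> {1..2 ^ n - 1}}"

definition sibling_edges :: "nat \<Rightarrow> nat set set" where
  "sibling_edges n = {{2 * x, 2 * x + 1} | x. x \<in> {1..2 ^ n - 1}}"

definition ST_edges :: "nat \<Rightarrow> nat set set" where
  "ST_edges n = binary_tree_edges n \<union> sibling_edges n"

end

theory Submission
  imports Defs "HOL-Library.Discrete_Functions"
begin

text \<open>
  Write \<open>l v\<close> for the level of \<open>v\<close>. The vertices with \<open>l v \<equiv> n - 1\<close> modulo 3, together with the
  root when 3 divides \<open>n\<close>, dominate the sibling tree: every other vertex has its parent or its
  children among them. Conversely, the closed neighbourhoods of the left children of these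
  vertices (and of the root itself, when 3 divides \<open>n\<close>) are pairwise disjoint, and a dominating
  set meets each of them, so no dominating set is smaller.
\<close>

text \<open>Comparing the level plus one with \<open>n\<close> avoids the truncated subtraction
  \<open>n - 1\<close> at \<open>n = 0\<close>.\<close>

definition ST_dom :: "nat \<Rightarrow> nat set" where
  "ST_dom n = {v \<in> ST_verts n. (floor_log v + 1) mod 3 = n mod 3 \<or> (n mod 3 = 0 \<and> v = 1)}"

lemma mem_ST_verts: "v \<in> ST_verts n \<longleftrightarrow> 1 \<le> v \<and> v < 2 ^ (n + 1)"
  by (auto simp: ST_verts_def)

lemma floor_log_double_Suc: "v > 0 \<Longrightarrow> floor_log (Suc (2 * v)) = Suc (floor_log v)"
  by (simp add: floor_log_rec)

lemma floor_log_quadruple: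
  assumes "v > 0"
  shows "floor_log (4 * v) = floor_log v + 2" "floor_log (Suc (4 * v)) = floor_log v + 2"
  using floor_log_twice[of v] floor_log_twice[of "2 * v"] floor_log_double_Suc[of "2 * v"] assms
  by simp_all

lemma floor_log_le_iff_less:
  assumes "v > 0"
  shows "floor_log v \<le> k \<longleftrightarrow> v < 2 ^ (k + 1)"
proof
  assume "floor_log v \<le> k"
  then have "(2::nat) ^ (floor_log v + 1) \<le> 2 ^ (k + 1)"
    by (intro power_increasing) auto
  then show "v < 2 ^ (k + 1)"
    using floor_log_exp2_gt[of v] unfolding power_add power_one_right by linarith
next
  assume "v < 2 ^ (k + 1)"
  then have "(2::nat) ^ floor_log v < 2 ^ (k + 1)"
    using floor_log_exp2_le[OF assms] by (rule le_less_trans[rotated])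
  then have "floor_log v < k + 1"
    by (rule power_less_imp_less_exp[rotated]) simp
  then show "floor_log v \<le> k"
    by simp
qed

lemma mem_ST_verts_floor_log: "v \<in> ST_verts n \<longleftrightarrow> v > 0 \<and> floor_log v \<le> n"
  using floor_log_le_iff_less[of v n] by (auto simp: mem_ST_verts)

lemma adjacent_ST_iff:
  "adjacent (ST_edges n) u v \<longleftrightarrow>
     (\<exists>x. 1 \<le> x \<and> x < 2 ^ n \<and>
       (u = x \<and> (v = 2 * x \<or> v = 2 * x + 1) \<or> v = x \<and> (u = 2 * x \<or> u = 2 * x + 1) \<or>
        u = 2 * x \<and> v = 2 * x + 1 \<or> v = 2 * x \<and> u = 2 * x + 1))"
proof -
  have "x \<in> {1..2 ^ n - 1} \<longleftrightarrow> 1 \<le> x \<and> x < 2 ^ n" for x :: nat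
    by auto
  then show ?thesis
    unfolding adjacent_def ST_edges_def binary_tree_edges_def sibling_edges_def
    by (auto simp: doubleton_eq_iff simp del: atLeastAtMost_iff)
qed

text \<open>A vertex outside the set lies on a level congruent to \<open>n\<close> or to
  \<open>n - 2\<close> modulo 3. In the first case its parent is in the set, in the second its
  children are.\<close>

lemma dominating_ST_dom: "dominating (ST_verts n) (ST_edges n) (ST_dom n)"
  unfolding dominating_def
proof (intro conjI ballI)
  show "ST_dom n \<subseteq> ST_verts n"
    by (auto simp: ST_dom_def)
next
  fix v assume v: "v \<in> ST_verts n - ST_dom n"
  then have pos: "v > 0" and lev: "floor_log v \<le> n"
    by (auto simp: mem_ST_verts_floor_log)
  have ne: "(floor_log v + 1) mod 3 \<noteq> n mod 3" "\<not> (n mod 3 = 0 \<and> v = 1)"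
    using v by (auto simp: ST_dom_def)
  show "\<exists>s\<in>ST_dom n. adjacent (ST_edges n) v s"
  proof (cases "floor_log v mod 3 = n mod 3")
    case True
    \<comment> \<open>The root has no parent. It falls in this case only if 3 divides
      \<open>n\<close>, and then it belongs to the set by the extra clause.\<close>
    with ne have "v \<ge> 2"
      using pos by (cases "v = 1") auto
    then have fl: "floor_log v = Suc (floor_log (v div 2))"
      by (rule floor_log_rec)
    have "v div 2 \<in> ST_dom n"
      using True fl lev \<open>v \<ge> 2\<close>
      by (simp add: ST_dom_def mem_ST_verts_floor_log del: floor_log_half)
    moreover have "v div 2 < 2 ^ n"
      using v by (auto simp: mem_ST_verts)
    then have "adjacent (ST_edges n) v (v div 2)"
      unfolding adjacent_ST_iff using \<open>v \<ge> 2\<close>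
      by (intro exI[of _ "v div 2"]) auto
    ultimately show ?thesis by blast
  next
    case False
    with ne(1) have eq: "(floor_log v + 2) mod 3 = n mod 3"
    proof -
      have "k mod 3 = 0 \<or> k mod 3 = 1 \<or> k mod 3 = 2" for k :: nat
        by presburger
      from this[of "floor_log v"] this[of n] show ?thesis
        using False ne(1) by (elim disjE) (simp_all add: mod_Suc)
    qed
    \<comment> \<open>Only level \<open>n\<close> is without children, and its residue belongs to
      the other case.\<close>
    have "floor_log v \<noteq> n"
      using False by blast
    then have "floor_log v < n"
      using lev by simp
    then have "v < 2 ^ n"
      using floor_log_le_iff_less[OF pos, of "n - 1"] by (cases n) auto
    then have "adjacent (ST_edges n) v (2 * v)"
      unfolding adjacent_ST_iff using pos by (intro exI[of _ v]) auto
    moreover have "2 * v \<in> ST_dom n"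
      using eq pos \<open>floor_log v < n\<close> by (simp add: ST_dom_def mem_ST_verts_floor_log)
    ultimately show ?thesis by blast
  qed
qed

text \<open>A superset of the closed neighbourhood of the packing vertex attached to \<open>d \<in> ST_dom n\<close>.\<close>

definition ST_cell :: "nat \<Rightarrow> nat \<Rightarrow> nat set" where
  "ST_cell n d =
     (if n mod 3 = 0 \<and> d = 1 then {1, 2, 3} else {d, 2 * d, 2 * d + 1, 4 * d, 4 * d + 1})"

text \<open>The only \<open>d \<in> ST_dom n\<close> whose cell can contain \<open>x\<close>, which proves the cells disjoint.\<close>

definition ST_owner :: "nat \<Rightarrow> nat \<Rightarrow> nat" where
  "ST_owner n x =
     (if n mod 3 = 0 \<and> x < 4 then 1
      else if (floor_log x + 1) mod 3 = n mod 3 then x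
      else if floor_log x mod 3 = n mod 3 then x div 2
      else x div 4)"

text \<open>Away from the root cell, a cell spans three consecutive levels, so the residue of the
  level of \<open>x\<close> tells whether to divide by 1, 2 or 4 to get back to
  \<open>d\<close>.\<close>

lemma ST_owner_cell:
  assumes "d \<in> ST_dom n" "x \<in> ST_cell n d"
  shows "ST_owner n x = d"
proof (cases "n mod 3 = 0 \<and> d = 1")
  case True
  then show ?thesis using assms(2) by (auto simp: ST_cell_def ST_owner_def)
next
  case False
  then have lev: "(floor_log d + 1) mod 3 = n mod 3" and pos: "d > 0"
    and x: "x \<in> {d, 2 * d, 2 * d + 1, 4 * d, 4 * d + 1}"
    using assms by (auto simp: ST_dom_def ST_cell_def mem_ST_verts)
  \<comment> \<open>If 3 divides \<open>n\<close>, then \<open>d\<close> has level congruent to 2,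
    hence at least 2. Its cell therefore misses the root cell \<open>{1, 2, 3}\<close>.\<close>
  have "x \<ge> 4" if "n mod 3 = 0"
  proof -
    have "\<not> floor_log d \<le> 1"
      using lev that by presburger
    then have "d \<ge> 4"
      using floor_log_le_iff_less[OF pos, of 1] by simp
    then show ?thesis using x by auto
  qed
  then have small: "\<not> (n mod 3 = 0 \<and> x < 4)"
    by auto
  consider "x = d" | "x div 2 = d" "floor_log x = floor_log d + 1"
    | "x div 4 = d" "floor_log x = floor_log d + 2"
    using x pos by (auto simp: floor_log_double_Suc floor_log_quadruple)
  then show ?thesis
  proof cases
    case 1
    then show ?thesis using lev small by (auto simp: ST_owner_def)
  next
    case 2
    have "(floor_log x + 1) mod 3 \<noteq> n mod 3" "floor_log x mod 3 = n mod 3"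
      using 2(2) lev by presburger+
    then show ?thesis using 2(1) small by (auto simp: ST_owner_def)
  next
    case 3
    have "(floor_log x + 1) mod 3 \<noteq> n mod 3" "floor_log x mod 3 \<noteq> n mod 3"
      using 3(2) lev by presburger+
    then show ?thesis using 3(1) small by (auto simp: ST_owner_def)
  qed
qed

text \<open>The vertex whose domination forces the intersection is \<open>1\<close> for the root
  cell and \<open>2 * d\<close> otherwise.\<close>

lemma dominating_meets_cell:
  assumes "dominating (ST_verts n) (ST_edges n) S" "d \<in> ST_dom n"
  shows "\<exists>s\<in>S. s \<in> ST_cell n d"
proof -
  have nbr: "\<exists>s\<in>S. v = s \<or> adjacent (ST_edges n) v s" if "v \<in> ST_verts n" for v
    using assms(1) that unfolding dominating_def by blast
  show ?thesis
  proof (cases "n mod 3 = 0 \<and> d = 1")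
    case True
    obtain s where "s \<in> S" "1 = s \<or> adjacent (ST_edges n) 1 s"
      using nbr[of 1] by (auto simp: mem_ST_verts_floor_log)
    moreover from this have "s \<in> {1, 2, 3}"
      by (auto simp: adjacent_ST_iff)
    ultimately show ?thesis using True by (auto simp: ST_cell_def)
  next
    case False
    then have lev: "(floor_log d + 1) mod 3 = n mod 3" "floor_log d \<le> n" and pos: "d > 0"
      using assms(2) by (auto simp: ST_dom_def mem_ST_verts_floor_log)
    \<comment> \<open>Level \<open>n\<close> has the wrong residue, so \<open>d\<close> is not a
      leaf and \<open>2 * d\<close> is a vertex.\<close>
    have "floor_log d \<noteq> n"
    proof
      assume "floor_log d = n"
      then have "(n + 1) mod 3 = n mod 3"
        using lev(1) by simp
      then show False by presburger
    qed
    with lev pos have "2 * d \<in> ST_verts n"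
      by (simp add: mem_ST_verts_floor_log)
    then obtain s where "s \<in> S" "2 * d = s \<or> adjacent (ST_edges n) (2 * d) s"
      using nbr by blast
    \<comment> \<open>Parity excludes \<open>2 * d\<close> from being a right child, which leaves
      its parent, its right sibling and its children.\<close>
    moreover from this(2) have "s \<in> {d, 2 * d, 2 * d + 1, 4 * d, 4 * d + 1}"
      unfolding adjacent_ST_iff by (elim disjE exE conjE; (simp; fail)?; presburger)
    then have "s \<in> ST_cell n d"
      using False by (simp only: ST_cell_def if_False)
    ultimately show ?thesis by blast
  qed
qed

text \<open>Choosing a point of \<open>S\<close> in every cell is injective, because
  \<open>ST_owner\<close> recovers the cell from the point.\<close>

lemma card_ST_dom_le:
  assumes "dominating (ST_verts n) (ST_edges n) S"
  shows "card (ST_dom n) \<le> card S"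
proof -
  obtain f where f: "\<And>d. d \<in> ST_dom n \<Longrightarrow> f d \<in> S \<and> f d \<in> ST_cell n d"
    using dominating_meets_cell[OF assms] by metis
  have "inj_on f (ST_dom n)"
    by (rule inj_on_inverseI[of _ "ST_owner n"]) (use f ST_owner_cell in blast)
  moreover have "f ` ST_dom n \<subseteq> S"
    using f by blast
  moreover have "finite S"
    using assms by (auto simp: dominating_def ST_verts_def intro: finite_subset)
  ultimately show ?thesis
    by (rule card_inj_on_le)
qed

lemma domination_number_ST: "domination_number (ST_verts n) (ST_edges n) = card (ST_dom n)"
  unfolding domination_number_def
proof (rule Min_eqI)
  have "{S. dominating (ST_verts n) (ST_edges n) S} \<subseteq> Pow (ST_verts n)"
    by (auto simp: dominating_def)
  moreover have "finite (Pow (ST_verts n))"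
    by (simp add: ST_verts_def)
  ultimately show "finite (card ` {S. dominating (ST_verts n) (ST_edges n) S})"
    by (meson finite_imageI finite_subset)
qed (use card_ST_dom_le dominating_ST_dom in auto)

text \<open>Since \<open>n\<close> and \<open>n + 3\<close> have the same residue, the old members
  stay, and of the three new levels only \<open>n + 2\<close> qualifies. The interval is exactly
  that level.\<close>

lemma ST_dom_add_3:
  "ST_dom (n + 3) = ST_dom n \<union> {2 ^ (n + 2)..<2 ^ (n + 3)}"
proof (rule set_eqI)
  fix v :: nat
  show "v \<in> ST_dom (n + 3) \<longleftrightarrow> v \<in> ST_dom n \<union> {2 ^ (n + 2)..<2 ^ (n + 3)}"
  proof (cases "v > 0")
    case True
    have band: "v \<in> {2 ^ (n + 2)..<2 ^ (n + 3)} \<longleftrightarrow> floor_log v = n + 2"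
      using floor_log_le_iff_less[OF True, of "n + 1"] floor_log_le_iff_less[OF True, of "n + 2"]
      by (auto simp: eval_nat_numeral)
    consider "floor_log v \<le> n" | "floor_log v = n + 1" | "floor_log v = n + 2"
      | "floor_log v = n + 3" | "floor_log v > n + 3"
      by linarith
    then have "(floor_log v + 1) mod 3 = n mod 3 \<and> floor_log v \<le> n + 3 \<longleftrightarrow>
        (floor_log v + 1) mod 3 = n mod 3 \<and> floor_log v \<le> n \<or> floor_log v = n + 2"
    proof cases
      case 2
      then show ?thesis by simp presburger
    next
      case 4
      then show ?thesis by simp presburger
    qed auto
    moreover have "floor_log v = 0" if "v = 1"
      using that by simp
    ultimately show ?thesis
      unfolding Un_iff band
      using True by (auto simp: ST_dom_def mem_ST_verts_floor_log)
  qed (auto simp: ST_dom_def mem_ST_verts)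
qed

lemma card_ST_dom_add_3: "card (ST_dom (n + 3)) = card (ST_dom n) + 2 ^ (n + 2)"
proof -
  have "ST_dom n \<inter> {2 ^ (n + 2)..<2 ^ (n + 3)} = {}"
    by (auto simp: ST_dom_def mem_ST_verts)
  moreover have "finite (ST_dom n)"
    by (simp add: ST_dom_def ST_verts_def)
  ultimately show ?thesis
    by (simp add: ST_dom_add_3 card_Un_disjoint power_add)
qed

lemma card_ST_dom_base: "card (ST_dom 0) = 1" "card (ST_dom 1) = 1" "card (ST_dom 2) = 2"
proof -
  have fl: "floor_log 2 = 1" "floor_log 3 = 1" "floor_log 4 = 2" "floor_log 5 = 2"
    "floor_log 6 = 2" "floor_log 7 = 2"
    by (simp_all add: floor_log_rec del: floor_log_half)
  have "ST_dom 0 = {1}"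
    by (auto simp: ST_dom_def mem_ST_verts)
  moreover have "ST_verts 1 = {1, 2, 3}"
    by (auto simp: mem_ST_verts)
  then have "ST_dom 1 = {1}"
    by (auto simp: ST_dom_def fl)
  moreover have "ST_verts 2 = {1, 2, 3, 4, 5, 6, 7}"
    by (auto simp: mem_ST_verts)
  then have "ST_dom 2 = {2, 3}"
    by (auto simp: ST_dom_def fl)
  ultimately show "card (ST_dom 0) = 1" "card (ST_dom 1) = 1" "card (ST_dom 2) = 2"
    by simp_all
qed

text \<open>This merges the three closed formulas into one identity over the naturals, free of
  division and subtraction.\<close>

lemma card_ST_dom:
  "7 * card (ST_dom n) + n mod 3 =
     2 ^ (n + 2) + (if n mod 3 = 0 then 3 else 0)"
proof (induction n rule: less_induct)
  case (less n)
  consider "n = 0" | "n = 1" | "n = 2" | m where "n = m + 3"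
    using le_Suc_ex[of 3 n] by force
  then show ?case
  proof cases
    \<comment> \<open>The induction step rests on
      \<open>2 ^ (m + 2) + 7 * 2 ^ (m + 2) = 2 ^ (m + 5)\<close>.\<close>
    case 4
    then show ?thesis
      using less.IH[of m] card_ST_dom_add_3[of m] by (simp add: power_add split: if_splits)
  qed (use card_ST_dom_base in simp_all)
qed

theorem theorem5:
  fixes n :: nat
  assumes "n \<ge> 1"
  shows "real (domination_number (ST_verts n) (ST_edges n)) =
    (if n mod 3 = 0 then 1 / 7 * (2 ^ (n + 2) + 3)
     else if n mod 3 = 1 then 1 / 7 * (2 ^ (n + 2) - 1)
     else 2 / 7 * (2 ^ (n + 1) - 1))"
proof -
  have "n mod 3 = 0 \<or> n mod 3 = 1 \<or> n mod 3 = 2"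
    by presburger
  moreover have "real (7 * card (ST_dom n) + n mod 3) =
     real (2 ^ (n + 2) + (if n mod 3 = 0 then 3 else 0))"
    by (simp only: card_ST_dom)
  ultimately show ?thesis
    unfolding domination_number_ST by (elim disjE) (simp_all add: field_simps)
qed

end
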